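(* As formal power series in $q$, \[ \sum_{n\geq 1} \frac{2q^n}{1+q^n}\, \frac{(-q;q)_{n-1}}{(q;q)_{n-1}} \;=\; \sum_{n\geq 0} \frac{q^{n(n+1)/2}}{(q;q)_n}\,\frac{2q^{n+1}}{1-q^{2(n+1)}}\, \frac{(-q^{n+2};q)_\infty}{(q^{n+2};q)_\infty}. \]
   Context: For a non-negative integer $L$, $(a;q)_L=\prod_{i=0}^{L-1}(1-aq^i)$ (so $(a;q)_0=1$), and $(a;q)_\infty=\lim_{L\to\infty}(a;q)_L$. *)

theory Defs
  imports
    "HOL-Analysis.Infinite_Sum"
    "HOL-Computational_Algebra.Formal_Power_Series"
begin

definition qpoch :: "'a::comm_ring_1 \<Rightarrow> 'a \<Rightarrow> nat \<Rightarrow> 'a" where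
  "qpoch a q L = (\<Prod>i<L. 1 - a * q ^ i)"

definition qpoch_inf :: "'a::{comm_ring_1,t2_space} \<Rightarrow> 'a \<Rightarrow> 'a" where
  "qpoch_inf a q = lim (\<lambda>L. qpoch a q L)"

text \<open>The limit defining \<^const>\<open>qpoch_inf\<close> is taken in the topology of coefficientwise
  convergence. It exists for base \<^term>\<open>fps_X\<close> and arbitrary \<^term>\<open>a\<close>, so
  \<^const>\<open>lim\<close> is not a junk value there.\<close>

lemma qpoch_tendsto_qpoch_inf:
  fixes a :: "'a::comm_ring_1 fps"
  shows "(\<lambda>L. qpoch a fps_X L) \<longlonglongrightarrow> qpoch_inf a fps_X"
proof -
  have stable: "fps_nth (qpoch a fps_X (Suc n + k)) n = fps_nth (qpoch a fps_X (Suc n)) n" for n k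
  proof (induction k)
    case (Suc k)
    have "qpoch a fps_X (Suc n + Suc k)
      = qpoch a fps_X (Suc n + k) - fps_X ^ (Suc n + k) * (a * qpoch a fps_X (Suc n + k))"
      by (simp add: qpoch_def algebra_simps)
    then show ?case
      using Suc by (simp only: fps_sub_nth fps_X_power_mult_nth) simp
  qed simp
  have "(\<lambda>L. qpoch a fps_X L) \<longlonglongrightarrow> Abs_fps (\<lambda>n. fps_nth (qpoch a fps_X (Suc n)) n)"
  proof (rule tendsto_fpsI)
    fix n
    show "eventually (\<lambda>L. fps_nth (qpoch a fps_X L) n
        = fps_nth (Abs_fps (\<lambda>n. fps_nth (qpoch a fps_X (Suc n)) n)) n) sequentially"
      using eventually_ge_at_top[of "Suc n"]
    proof eventually_elim
      case (elim L)
      then show ?case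
        using stable[of n "L - Suc n"] by simp
    qed
  qed
  then show ?thesis
    unfolding qpoch_inf_def by (simp add: convergentI convergent_LIMSEQ_iff[symmetric])
qed

end

theory Submission
  imports Defs
begin

text \<open>
  This is a case of Jackson's transformation of a \<open>\<^sub>2\<phi>\<^sub>1\<close> into a \<open>\<^sub>2\<phi>\<^sub>2\<close>. Expanding
  \<open>1 / (1 + q\<^sup>n\<^sup>+\<^sup>1)\<close> by q-Chu-Vandermonde and summing first along \<open>j = n - k\<close>, the inner sum
  \<open>\<Sum>\<^sub>j q\<^sup>j (-q\<^sup>k\<^sup>+\<^sup>1;q)\<^sub>j / (q;q)\<^sub>j\<close> telescopes to a quotient of products. Everything is carried
  out on partial sums: those of the two sides up to index \<open>N\<close> agree modulo \<open>q\<^sup>N\<^sup>+\<^sup>1\<close>, because the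
  \<open>k\<close>-th coefficient is divisible by \<open>q\<^sup>k\<^sup>+\<^sup>1\<close> and its product, truncated at \<open>N - k\<close> factors, is
  correct modulo \<open>q\<^sup>N\<^sup>-\<^sup>k\<close>.
\<close>

section \<open>Coefficientwise convergence of products and sums of power series\<close>

lemma fps_X_power_dvd_iff:
  fixes f :: "'a::comm_ring_1 fps"
  shows "fps_X ^ n dvd f \<longleftrightarrow> (\<forall>i<n. fps_nth f i = 0)"
proof
  assume "\<forall>i<n. fps_nth f i = 0"
  then have "f = fps_X ^ n * fps_shift n f"
    by (auto simp: fps_eq_iff fps_X_power_mult_nth)
  then show "fps_X ^ n dvd f"
    by (rule dvdI)
qed (auto simp: dvd_def fps_X_power_mult_nth)

lemma tendsto_mult_fps:
  fixes f g :: "'b \<Rightarrow> 'a::comm_ring_1 fps"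
  assumes "(f \<longlongrightarrow> a) F" and "(g \<longlongrightarrow> b) F"
  shows "((\<lambda>x. f x * g x) \<longlongrightarrow> a * b) F"
proof (rule tendsto_fpsI)
  fix n
  have "\<forall>\<^sub>F x in F. \<forall>i\<in>{..n}. fps_nth (f x) i = fps_nth a i \<and> fps_nth (g x) i = fps_nth b i"
    using assms by (subst eventually_ball_finite_distrib) (auto simp: tendsto_fps_iff intro: eventually_conj)
  then show "\<forall>\<^sub>F x in F. fps_nth (f x * g x) n = fps_nth (a * b) n"
    by eventually_elim (auto simp: fps_mult_nth intro!: sum.cong)
qed

text \<open>The terms with \<open>n > i\<close> do not reach coefficient \<open>i\<close>, so that
  coefficient is the same for every finite index set containing \<open>{..i}\<close>.\<close>

lemma has_sum_fps:
  fixes f :: "nat \<Rightarrow> 'a::comm_ring_1 fps"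
  assumes "\<And>n. fps_X ^ n dvd f n" and "\<And>N. fps_X ^ Suc N dvd S - (\<Sum>n\<le>N. f n)"
  shows "(f has_sum S) UNIV"
  unfolding has_sum_def
proof (rule tendsto_fpsI)
  fix i
  have "fps_nth (sum f Y) i = fps_nth S i" if Y: "finite Y" "{..i} \<subseteq> Y" for Y
  proof -
    have "fps_nth (sum f Y) i = (\<Sum>n\<in>Y. fps_nth (f n) i)"
      by (simp add: fps_sum_nth)
    also have "\<dots> = (\<Sum>n\<le>i. fps_nth (f n) i)"
      using Y assms(1) by (intro sum.mono_neutral_right) (auto simp: fps_X_power_dvd_iff)
    also have "\<dots> = fps_nth S i"
      using assms(2)[of i] unfolding fps_X_power_dvd_iff by (auto simp: fps_sum_nth)
    finally show ?thesis .
  qed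
  then show "\<forall>\<^sub>F Y in finite_subsets_at_top UNIV. fps_nth (sum f Y) i = fps_nth S i"
    unfolding eventually_finite_subsets_at_top by (intro exI[of _ "{..i}"]) auto
qed

text \<open>This lets two series be compared through their partial sums alone, with no closed form
  for the common value: \<open>S\<close> takes its \<open>i\<close>-th coefficient from the partial
  sum up to \<open>i\<close>, which later terms leave unchanged.\<close>

lemma has_sum_fps_common:
  fixes f g :: "nat \<Rightarrow> 'a::comm_ring_1 fps"
  assumes f: "\<And>n. fps_X ^ n dvd f n" and g: "\<And>n. fps_X ^ n dvd g n"
    and fg: "\<And>N. fps_X ^ Suc N dvd (\<Sum>n\<le>N. f n) - (\<Sum>n\<le>N. g n)"
  shows "\<exists>S. (f has_sum S) UNIV \<and> (g has_sum S) UNIV"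
proof -
  define S where "S = Abs_fps (\<lambda>i. fps_nth (\<Sum>n\<le>i. f n) i)"
  have S: "fps_X ^ Suc N dvd S - (\<Sum>n\<le>N. f n)" for N
    unfolding fps_X_power_dvd_iff
  proof (intro allI impI)
    fix i assume "i < Suc N"
    then have "(\<Sum>n\<le>i. fps_nth (f n) i) = (\<Sum>n\<le>N. fps_nth (f n) i)"
      using f by (intro sum.mono_neutral_left) (auto simp: fps_X_power_dvd_iff)
    then show "fps_nth (S - (\<Sum>n\<le>N. f n)) i = 0"
      by (simp add: S_def fps_sum_nth)
  qed
  have "fps_X ^ Suc N dvd S - (\<Sum>n\<le>N. g n)" for N
    using dvd_add[OF S[of N] fg[of N]] by simp
  then show ?thesis
    using has_sum_fps[OF f S] has_sum_fps[OF g] by blast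
qed

section \<open>Finite and infinite q-Pochhammer products and their inverses\<close>

lemma qpoch_0 [simp]: "qpoch a q 0 = 1"
  by (simp add: qpoch_def)

lemma qpoch_Suc: "qpoch a q (Suc n) = qpoch a q n * (1 - a * q ^ n)"
  by (simp add: qpoch_def)

lemma qpoch_add: "qpoch a q (m + n) = qpoch a q m * qpoch (a * q ^ m) q n"
  by (induction n) (simp_all add: qpoch_Suc power_add mult_ac)

lemma qpoch_nth_0: "fps_nth a 0 = 0 \<Longrightarrow> fps_nth (qpoch a q n) 0 = 1"
  by (induction n) (simp_all add: qpoch_Suc)

lemma qpoch_inf_split:
  fixes a :: "'a::comm_ring_1 fps"
  shows "qpoch_inf a fps_X = qpoch a fps_X m * qpoch_inf (a * fps_X ^ m) fps_X"
proof (rule LIMSEQ_unique)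
  show "(\<lambda>n. qpoch a fps_X (n + m)) \<longlonglongrightarrow> qpoch_inf a fps_X"
    by (rule LIMSEQ_ignore_initial_segment[OF qpoch_tendsto_qpoch_inf])
  show "(\<lambda>n. qpoch a fps_X (n + m)) \<longlonglongrightarrow> qpoch a fps_X m * qpoch_inf (a * fps_X ^ m) fps_X"
    unfolding add.commute[of _ m] qpoch_add
    by (intro tendsto_mult_fps tendsto_const qpoch_tendsto_qpoch_inf)
qed

text \<open>All factors of index at least \<open>m\<close> are 1 modulo \<open>fps_X ^ m\<close>, so
  appending them changes no coefficient below \<open>m\<close>.\<close>

lemma qpoch_inf_minus_qpoch_dvd:
  fixes a :: "'a::comm_ring_1 fps"
  shows "fps_X ^ m dvd qpoch_inf a fps_X - qpoch a fps_X m"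
  unfolding fps_X_power_dvd_iff
proof (intro allI impI)
  fix i assume i: "i < m"
  have dvd: "fps_X ^ m dvd qpoch a fps_X (m + n) - qpoch a fps_X m" for n
  proof (induction n)
    case (Suc n)
    have "qpoch a fps_X (m + Suc n) - qpoch a fps_X m
      = (qpoch a fps_X (m + n) - qpoch a fps_X m)
        - fps_X ^ m * (fps_X ^ n * a * qpoch a fps_X (m + n))"
      by (simp add: qpoch_Suc algebra_simps power_add)
    then show ?case
      using Suc by (metis dvd_diff dvd_triv_left)
  qed simp
  have "\<forall>\<^sub>F n in sequentially. fps_nth (qpoch a fps_X n) i = fps_nth (qpoch_inf a fps_X) i"
    using qpoch_tendsto_qpoch_inf[of a] by (simp add: tendsto_fps_iff)
  then obtain k where k: "\<And>n. n \<ge> k \<Longrightarrow> fps_nth (qpoch a fps_X n) i = fps_nth (qpoch_inf a fps_X) i"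
    by (auto simp: eventually_sequentially)
  \<comment> \<open>The index \<open>m + k\<close> lies past both thresholds: there coefficient
    \<open>i\<close> agrees with that of the limit and with that of the product of \<open>m\<close>
    factors.\<close>
  show "fps_nth (qpoch_inf a fps_X - qpoch a fps_X m) i = 0"
    using dvd[of k] k[of "m + k"] i unfolding fps_X_power_dvd_iff by simp
qed

lemma qpoch_inf_nth_0:
  fixes a :: "'a::comm_ring_1 fps"
  assumes "fps_nth a 0 = 0"
  shows "fps_nth (qpoch_inf a fps_X) 0 = 1"
  using qpoch_inf_minus_qpoch_dvd[of 1 a] qpoch_nth_0[OF assms, of fps_X 1]
  unfolding fps_X_power_dvd_iff by simp

lemma fps_mult_inverse_eq_1:
  fixes f :: "'a::field fps"
  shows "fps_nth f 0 = 1 \<Longrightarrow> f * inverse f = 1"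
  by (metis inverse_mult_eq_1' one_neq_zero)

lemma inverse_qpoch_Suc:
  fixes a :: "'a::field fps"
  assumes "fps_nth a 0 = 0"
  shows "inverse (qpoch a q n) = inverse (qpoch a q (Suc n)) * (1 - a * q ^ n)"
proof -
  have "(1 - a * q ^ n) * inverse (1 - a * q ^ n) = 1"
    using assms by (intro fps_mult_inverse_eq_1) simp
  then show ?thesis
    by (simp add: qpoch_Suc fps_inverse_mult mult_ac)
qed

section \<open>Finite q-series identities\<close>

text \<open>The sum telescopes: the right-hand sides for \<open>n + 1\<close> and \<open>n\<close>
  differ by the summand with \<open>j = n + 1\<close>, because
  \<open>(1 - a q^(n+1)) - (1 - q^(n+1)) = (1 - a) q^(n+1)\<close> and the factor
  \<open>1 - a\<close> completes \<open>qpoch (a * fps_X) fps_X n\<close> to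
  \<open>qpoch a fps_X (Suc n)\<close>.\<close>

lemma sum_qbinomial:
  fixes a :: "'a::field fps"
  shows "(\<Sum>j\<le>n. fps_X ^ j * qpoch a fps_X j * inverse (qpoch fps_X fps_X j))
    = qpoch (a * fps_X) fps_X n * inverse (qpoch fps_X fps_X n)"
proof (induction n)
  case (Suc n)
  have split: "qpoch a fps_X (Suc n) = (1 - a) * qpoch (a * fps_X) fps_X n"
    using qpoch_add[of a fps_X 1 n] by (simp add: qpoch_Suc)
  show ?case
    by (simp add: Suc split inverse_qpoch_Suc[of fps_X fps_X n] qpoch_Suc[of "a * fps_X"])
      (simp add: algebra_simps)
qed simp

text \<open>For \<open>m = n\<close> this is the q-Chu-Vandermonde sum of \<open>(b;q)\<^sub>n / (bq;q)\<^sub>n\<close>.\<close>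

lemma inverse_expansion_remainder:
  fixes b :: "'a::field fps"
  assumes b: "fps_nth b 0 = 0" and "m \<le> n"
  defines "U \<equiv> \<lambda>m. qpoch fps_X fps_X n * inverse (qpoch fps_X fps_X (n - m))
    * (- b) ^ m * fps_X ^ (\<Sum>i<m. i)"
  shows "inverse (1 - b * fps_X ^ n)
    = (\<Sum>k<m. U k * inverse (qpoch b fps_X (Suc k)))
      + U m * inverse (qpoch b fps_X m) * inverse (1 - b * fps_X ^ n)"
  using \<open>m \<le> n\<close>
proof (induction m)
  case 0
  have "qpoch fps_X fps_X n * inverse (qpoch fps_X fps_X n) = (1 :: 'a fps)"
    by (intro fps_mult_inverse_eq_1 qpoch_nth_0) simp
  then show ?case
    by (simp add: U_def)
next
  case (Suc m)
  define d where "d = n - Suc m"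
  have n: "n = Suc (m + d)"
    using Suc.prems by (simp add: d_def)
  define v where "v = inverse (1 - b * fps_X ^ n)"
  define w where "w = inverse (qpoch b fps_X (Suc m))"
  define P where "P = qpoch fps_X fps_X n * inverse (qpoch fps_X fps_X d) * (- b) ^ m * fps_X ^ (\<Sum>i<m. i)"
  have v: "(1 - b * fps_X ^ n) * v = 1"
    unfolding v_def using b by (intro fps_mult_inverse_eq_1) simp
  have w: "inverse (qpoch b fps_X m) = w * (1 - b * fps_X ^ m)"
    unfolding w_def using b by (rule inverse_qpoch_Suc)
  define r where "r = inverse (qpoch fps_X fps_X (Suc d) :: 'a fps)"
  have r: "inverse (qpoch fps_X fps_X d) = r * (1 - fps_X ^ Suc d)"
    unfolding r_def by (subst inverse_qpoch_Suc) simp_all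
  define C where "C = qpoch fps_X fps_X n * (- b) ^ m * fps_X ^ (\<Sum>i<m. i)"
  have Um: "U m = C * r"
    by (simp add: U_def C_def r_def n mult_ac)
  have USm: "U (Suc m) = - (C * r * (1 - fps_X ^ Suc d) * b * fps_X ^ m)"
    by (simp only: U_def C_def d_def[symmetric] r) (simp add: power_add mult_ac)
  have "U m * inverse (qpoch b fps_X m) * v = C * r * w * ((1 - b * fps_X ^ m) * v)"
    by (simp add: Um w mult_ac)
  \<comment> \<open>Since \<open>n - m = Suc d\<close>, this splits the remainder in two: in the
    first part \<open>v\<close> cancels and leaves the new summand \<open>k = m\<close>, while the
    second is the remainder for \<open>Suc m\<close>.\<close>
  also have "(1 - b * fps_X ^ m) * v
      = (1 - b * fps_X ^ n) * v - b * fps_X ^ m * (1 - fps_X ^ Suc d) * v"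
    by (simp add: n power_add algebra_simps)
  also have "C * r * w * \<dots> = U m * w + U (Suc m) * w * v"
    by (simp only: v Um USm) (simp add: algebra_simps)
  finally show ?case
    using Suc by (simp add: v_def w_def add.assoc)
qed

text \<open>At \<open>m = n\<close> the remainder is itself the summand \<open>k = n\<close>, as
  \<open>1 - b * fps_X ^ n\<close> is the last factor of
  \<open>qpoch b fps_X (Suc n)\<close>.\<close>

lemma inverse_expansion:
  fixes b :: "'a::field fps"
  assumes b: "fps_nth b 0 = 0"
  shows "inverse (1 - b * fps_X ^ n)
    = (\<Sum>k\<le>n. qpoch fps_X fps_X n * inverse (qpoch fps_X fps_X (n - k))
        * (- b) ^ k * fps_X ^ (\<Sum>i<k. i) * inverse (qpoch b fps_X (Suc k)))"
  using inverse_expansion_remainder[OF b, of n n]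
  by (simp add: lessThan_Suc_atMost[symmetric] qpoch_Suc fps_inverse_mult mult.assoc)

text \<open>This is an exact finite form of the identity, with \<open>n\<close> shifted to start at
  0. Expanding \<open>1 / (1 + q^(n+1))\<close> gives a double sum over the triangle
  \<open>k + j \<le> N\<close>; summing over \<open>j\<close> first leaves a truncated product for
  each \<open>k\<close>.\<close>

lemma partial_sums_eq:
  fixes c :: "nat \<Rightarrow> 'a::field fps"
  defines "c \<equiv> \<lambda>k. 2 * fps_X ^ Suc k * fps_X ^ (\<Sum>i<Suc k. i) * inverse (1 + fps_X ^ Suc k)"
  shows "(\<Sum>n\<le>N. 2 * fps_X ^ Suc n * inverse (1 + fps_X ^ Suc n)
        * (qpoch (- fps_X) fps_X n * inverse (qpoch fps_X fps_X n)))
    = (\<Sum>k\<le>N. c k * (qpoch (- (fps_X ^ (k + 2))) fps_X (N - k) * inverse (qpoch fps_X fps_X (N - k))))"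
proof -
  \<comment> \<open>\<open>F k j\<close> is what the \<open>k\<close>-th term of the expansion
    contributes to the summand \<open>n = k + j\<close>.\<close>
  define F where "F k j = c k * (fps_X ^ j * qpoch (- (fps_X ^ Suc k)) fps_X j
    * inverse (qpoch fps_X fps_X j))" for k j :: nat
  have "2 * fps_X ^ Suc n * inverse (1 + fps_X ^ Suc n)
        * (qpoch (- fps_X) fps_X n * inverse (qpoch fps_X fps_X n)) = (\<Sum>k\<le>n. F k (n - k))" for n
  proof -
    have cancel: "qpoch fps_X fps_X n * inverse (qpoch fps_X fps_X n) = (1 :: 'a fps)"
      by (intro fps_mult_inverse_eq_1 qpoch_nth_0) simp
    \<comment> \<open>The choice \<open>b = - fps_X\<close> also removes all signs, since
      \<open>(- b) ^ k\<close> becomes \<open>fps_X ^ k\<close>.\<close>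
    have expansion: "inverse (1 - (- fps_X) * fps_X ^ n :: 'a fps)
      = (\<Sum>k\<le>n. qpoch fps_X fps_X n * inverse (qpoch fps_X fps_X (n - k))
          * (- (- fps_X)) ^ k * fps_X ^ (\<Sum>i<k. i) * inverse (qpoch (- fps_X) fps_X (Suc k)))"
      by (rule inverse_expansion) simp
    have "2 * fps_X ^ Suc n * inverse (1 + fps_X ^ Suc n)
        * (qpoch (- fps_X) fps_X n * inverse (qpoch fps_X fps_X n))
      = 2 * fps_X ^ Suc n * qpoch (- fps_X) fps_X n * inverse (qpoch fps_X fps_X n)
        * inverse (1 - (- fps_X) * fps_X ^ n :: 'a fps)"
      by (simp add: mult_ac)
    also have "\<dots> = (\<Sum>k\<le>n. F k (n - k))"
      unfolding expansion sum_distrib_left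
    proof (intro sum.cong refl)
      fix k assume "k \<in> {..n}"
      then obtain j where n: "n = k + j"
        by (auto simp: le_iff_add)
      have split: "qpoch (- fps_X) fps_X n
          = qpoch (- fps_X) fps_X k * qpoch (- (fps_X ^ Suc k)) fps_X j"
        by (simp add: n qpoch_add)
      have quot: "qpoch (- fps_X) fps_X k * inverse (qpoch (- fps_X) fps_X (Suc k))
          = inverse (1 + fps_X ^ Suc k :: 'a fps)"
        using fps_mult_inverse_eq_1[OF qpoch_nth_0[of "- fps_X :: 'a fps" fps_X k]]
        by (simp add: qpoch_Suc fps_inverse_mult mult.assoc[symmetric])
      have "2 * fps_X ^ Suc n * qpoch (- fps_X) fps_X n * inverse (qpoch fps_X fps_X n)
          * (qpoch fps_X fps_X n * inverse (qpoch fps_X fps_X (n - k)) * (- (- fps_X)) ^ k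
             * fps_X ^ (\<Sum>i<k. i) * inverse (qpoch (- fps_X) fps_X (Suc k)))
        = qpoch fps_X fps_X n * inverse (qpoch fps_X fps_X n)
          * (qpoch (- fps_X) fps_X k * inverse (qpoch (- fps_X) fps_X (Suc k)))
          * (2 * fps_X ^ Suc n * fps_X ^ k * fps_X ^ (\<Sum>i<k. i)
             * qpoch (- (fps_X ^ Suc k)) fps_X j * inverse (qpoch fps_X fps_X j) :: 'a fps)"
        unfolding split by (simp add: n mult_ac)
      \<comment> \<open>The spare \<open>fps_X ^ k\<close> extends the triangular exponent from
        \<open>\<Sum>i<k. i\<close> to \<open>\<Sum>i<Suc k. i\<close>.\<close>
      also have "\<dots> = F k (n - k)"
        unfolding cancel quot by (simp add: F_def c_def n power_add mult_ac)
      finally show "2 * fps_X ^ Suc n * qpoch (- fps_X) fps_X n * inverse (qpoch fps_X fps_X n)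
          * (qpoch fps_X fps_X n * inverse (qpoch fps_X fps_X (n - k)) * (- (- fps_X)) ^ k
             * fps_X ^ (\<Sum>i<k. i) * inverse (qpoch (- fps_X) fps_X (Suc k))) = F k (n - k)" .
    qed
    finally show ?thesis .
  qed
  moreover have "(\<Sum>n\<le>N. \<Sum>k\<le>n. F k (n - k)) = (\<Sum>k\<le>N. \<Sum>j\<le>N - k. F k j)"
    by (induction N) (simp_all add: Suc_diff_le sum.distrib)
  \<comment> \<open>The inner sum is \<open>sum_qbinomial\<close> with
    \<open>a = - (fps_X ^ Suc k)\<close>.\<close>
  moreover have "(\<Sum>j\<le>m. F k j)
      = c k * (qpoch (- (fps_X ^ (k + 2))) fps_X m * inverse (qpoch fps_X fps_X m))" for k m
    by (simp only: F_def sum_distrib_left[symmetric] sum_qbinomial) (simp add: mult_ac)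
  ultimately show ?thesis
    by simp
qed

section \<open>Infinite products and their truncations\<close>

text \<open>The factors \<open>qpoch fps_X fps_X k\<close>, \<open>1 - q^(k+1)\<close> and the
  infinite denominator combine to \<open>qpoch_inf fps_X fps_X\<close>, which does not depend on
  \<open>k\<close>; only \<open>1 + q^(k+1)\<close> is left over from
  \<open>1 - q^(2(k+1))\<close>.\<close>

lemma product_term_eq:
  fixes k :: nat
  shows "fps_X ^ (k * (k + 1) div 2) / qpoch fps_X fps_X k
      * (2 * fps_X ^ (k + 1) / (1 - fps_X ^ (2 * (k + 1))))
      * (qpoch_inf (- (fps_X ^ (k + 2))) fps_X / qpoch_inf (fps_X ^ (k + 2)) fps_X)
    = 2 * fps_X ^ Suc k * fps_X ^ (\<Sum>i<Suc k. i) * inverse (1 + fps_X ^ Suc k)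
      * (qpoch_inf (- (fps_X ^ (k + 2))) fps_X * inverse (qpoch_inf fps_X fps_X :: 'a::field fps))"
proof -
  have triangle: "k * (k + 1) div 2 = (\<Sum>i<Suc k. i)"
    by (induction k) auto
  have "qpoch_inf fps_X fps_X
      = qpoch fps_X fps_X k * (1 - fps_X ^ (k + 1)) * qpoch_inf (fps_X ^ (k + 2)) (fps_X :: 'a fps)"
    using qpoch_inf_split[of fps_X "Suc k"] by (simp add: qpoch_Suc)
  moreover have "1 - fps_X ^ (2 * (k + 1)) = (1 - fps_X ^ (k + 1)) * (1 + fps_X ^ (k + 1) :: 'a fps)"
    unfolding mult.commute[of 2] power_mult by (simp add: algebra_simps power2_eq_square)
  ultimately show ?thesis
    unfolding triangle
    by (simp add: fps_divide_unit fps_inverse_mult qpoch_nth_0 qpoch_inf_nth_0 mult_ac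
        del: sum.lessThan_Suc)
qed

lemma truncation_dvd:
  fixes a :: "'a::field fps"
  shows "fps_X ^ m dvd qpoch_inf a fps_X * inverse (qpoch_inf fps_X fps_X)
    - qpoch a fps_X m * inverse (qpoch fps_X fps_X m)"
proof -
  define A P B Q where "A = qpoch_inf a fps_X" and "P = qpoch a fps_X m"
    and "B = qpoch_inf fps_X (fps_X :: 'a fps)" and "Q = qpoch fps_X (fps_X :: 'a fps) m"
  have B: "B * inverse B = 1" and Q: "Q * inverse Q = 1"
    unfolding B_def Q_def by (simp_all add: fps_mult_inverse_eq_1 qpoch_inf_nth_0 qpoch_nth_0)
  \<comment> \<open>Over the common denominator \<open>B * Q\<close> the numerator is
    \<open>A * Q - P * B = (A - P) * Q - (B - Q) * P\<close>, and both differences are divisible by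
    \<open>fps_X ^ m\<close>.\<close>
  have "A * inverse B - P * inverse Q
      = A * inverse B * (Q * inverse Q) - P * inverse Q * (B * inverse B)"
    unfolding B Q by simp
  also have "\<dots> = (A - P) * (Q * inverse B * inverse Q) - (B - Q) * (P * inverse B * inverse Q)"
    by (simp add: algebra_simps)
  also have "fps_X ^ m dvd \<dots>"
    unfolding A_def P_def B_def Q_def
    by (rule dvd_diff[OF dvd_mult2 dvd_mult2]) (rule qpoch_inf_minus_qpoch_dvd)+
  finally show ?thesis
    by (simp only: A_def B_def P_def Q_def)
qed

theorem theorem3p3:
  fixes q :: "'a::field_char_0 fps"
  assumes "q = fps_X"
  shows "(\<lambda>n. 2 * q ^ n / (1 + q ^ n) * (qpoch (- q) q (n - 1) / qpoch q q (n - 1)))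
           summable_on {1..} \<and>
         (\<lambda>n. q ^ (n * (n + 1) div 2) / qpoch q q n
             * (2 * q ^ (n + 1) / (1 - q ^ (2 * (n + 1))))
             * (qpoch_inf (- (q ^ (n + 2))) q / qpoch_inf (q ^ (n + 2)) q))
           summable_on UNIV \<and>
         (\<Sum>\<^sub>\<infinity>n\<in>{1..}. 2 * q ^ n / (1 + q ^ n) * (qpoch (- q) q (n - 1) / qpoch q q (n - 1)))
       = (\<Sum>\<^sub>\<infinity>n. q ^ (n * (n + 1) div 2) / qpoch q q n
             * (2 * q ^ (n + 1) / (1 - q ^ (2 * (n + 1))))
             * (qpoch_inf (- (q ^ (n + 2))) q / qpoch_inf (q ^ (n + 2)) q))"
    (is "?f summable_on _ \<and> ?g summable_on _ \<and> _")
proof -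
  define c :: "nat \<Rightarrow> 'a fps" where
    "c k = 2 * fps_X ^ Suc k * fps_X ^ (\<Sum>i<Suc k. i) * inverse (1 + fps_X ^ Suc k)" for k
  have f: "?f (Suc n) = 2 * fps_X ^ Suc n * inverse (1 + fps_X ^ Suc n)
      * (qpoch (- fps_X) fps_X n * inverse (qpoch fps_X fps_X n))" for n
    using assms by (simp add: fps_divide_unit qpoch_nth_0)
  have g: "?g k = c k * (qpoch_inf (- (fps_X ^ (k + 2))) fps_X * inverse (qpoch_inf fps_X fps_X))" for k
    unfolding assms c_def by (rule product_term_eq)
  have X_dvd: "fps_X ^ Suc n dvd 2 * fps_X ^ Suc n * a" for n and a :: "'a fps"
    by simp
  have c_dvd: "fps_X ^ Suc k dvd c k" for k
    unfolding c_def mult.assoc[of "2 * _"] by (rule X_dvd)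
  have "\<exists>S. ((\<lambda>n. ?f (Suc n)) has_sum S) UNIV \<and> (?g has_sum S) UNIV"
  proof (rule has_sum_fps_common)
    fix n
    show "fps_X ^ n dvd ?f (Suc n)"
      unfolding f mult.assoc[of "2 * _"] by (rule power_le_dvd[OF X_dvd]) simp
    show "fps_X ^ n dvd ?g n"
      unfolding g by (rule dvd_mult2[OF power_le_dvd[OF c_dvd]]) simp
    \<comment> \<open>The truncation error is divisible only by \<open>fps_X ^ (n - k)\<close>; the
      missing \<open>fps_X ^ Suc k\<close> comes from \<open>c k\<close>.\<close>
    have "fps_X ^ Suc n dvd c k * (qpoch (- (fps_X ^ (k + 2))) fps_X (n - k)
        * inverse (qpoch fps_X fps_X (n - k))) - ?g k" if "k \<le> n" for k
    proof -
      have "fps_X ^ Suc n = fps_X ^ Suc k * (fps_X ^ (n - k) :: 'a fps)"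
        using that by (simp flip: power_add)
      then show ?thesis
        unfolding g right_diff_distrib[symmetric]
        by (metis mult_dvd_mono[OF c_dvd truncation_dvd] dvd_diff_commute right_diff_distrib)
    qed
    then show "fps_X ^ Suc n dvd (\<Sum>n\<le>n. ?f (Suc n)) - (\<Sum>k\<le>n. ?g k)"
      unfolding f partial_sums_eq c_def[symmetric] sum_subtractf[symmetric]
      by (intro dvd_sum) simp
  qed
  then obtain S where S: "((\<lambda>n. ?f (Suc n)) has_sum S) UNIV" "(?g has_sum S) UNIV"
    by blast
  \<comment> \<open>Reindexing along \<open>Suc\<close> returns to the original summation range
    \<open>{1..}\<close>.\<close>
  have "(?f has_sum S) (range Suc)"
    using S(1) by (subst has_sum_reindex) (simp_all add: o_def)
  moreover have "range Suc = {1..}"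
    by (auto simp: image_iff Suc_le_eq gr0_conv_Suc)
  ultimately have f_sum: "(?f has_sum S) {1..}"
    by simp
  show ?thesis
    unfolding infsumI[OF f_sum] infsumI[OF S(2)]
    by (intro conjI refl has_sum_imp_summable[OF f_sum] has_sum_imp_summable[OF S(2)])
qed

end
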